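(* Let $X$ be a topological space, $\mathcal U$ an open covering of $X$, $F$ a presheaf of abelian groups on $X$, and $\pi:\mathcal A(\mathcal U)\to\mathcal U$ a map such that $V\subseteq\pi(V)$ for every object $V$ of $\mathcal A(\mathcal U)$ and $\pi(U)=U$ for $U\in\mathcal U$. Then the cochain map $$\pi^*:C^\bullet(K(\mathcal U);F^\vee)\to C^\bullet(N(\mathcal U);F_* ),\qquad (\pi^*c)(V_0\to\cdots\to V_n)=c(\pi(V_0),\dots,\pi(V_n))|_{V_0},$$ is a homotopy equivalence of cochain complexes.
   Context: $\mathcal A(\mathcal U)$ is the poset whose objects are the non-empty finite intersections of elements of $\mathcal U$ (as open sets), with an arrow $V\to V'$ iff $V\subseteq V'$. $K(\mathcal U)$ is the nerve of the covering: $K_n(\mathcal U)$ is the set of sequences $(U_0,\dots,U_n)$ of elements of $\mathcal U$ with $U_0\cap\dots\cap U_n\neq\emptyset$. The Čech complex is $C^n(K(\mathcal U);F^\vee)=\prod_{(U_0,\dots,U_n)\in K_n(\mathcal U)}F(U_0\cap\dots\cap U_n)$ with differential $(\delta c)(U_0,\dots,U_{n+1})=\sum_{i=0}^{n+1}(-1)^ic(U_0,\dots,\widehat{U_i},\dots,U_{n+1})|_{U_0\cap\dots\cap U_{n+1}}$. $N(\mathcal U)$ is the nerve of the category $\mathcal A(\mathcal U)$: $N_n(\mathcal U)$ is the set of sequences $V_0\to V_1\to\cdots\to V_n$ in $\mathcal A(\mathcal U)$ (i.e. $V_0\subseteq V_1\subseteq\dots\subseteq V_n$, repetitions allowed). The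 complex is $C^n(N(\mathcal U);F_* )=\prod_{(V_0\to\cdots\to V_n)\in N_n(\mathcal U)}F(V_0)$ with differential $(\delta c)(V_0\to\cdots\to V_{n+1})=\sum_{i=0}^{n+1}(-1)^ic(V_0\to\cdots\widehat{V_i}\cdots\to V_{n+1})|_{V_0}$, where $\widehat{V_i}$ means that $V_i$ is deleted (restriction is needed only for $i=0$). A cochain map $f:C\to D$ is a homotopy equivalence if there is a cochain map $g:D\to C$ such that $g\circ f$ and $f\circ g$ are cochain homotopic to the identities. *)

theory Defs
  imports "HOL-Analysis.Abstract_Topology" "HOL-Algebra.Product_Groups" "HOL-Algebra.FiniteProduct"
begin

text \<open>
  Abelian groups are commutative groups in the sense of HOL-Algebra and hence written
  multiplicatively: an alternating sum becomes a product of \<^term>\<open>(-1)^i\<close>-th powers, and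
  a difference \<open>x - y\<close> becomes \<open>x \<otimes> inv y\<close>.
\<close>

section \<open>Presheaves of abelian groups\<close>

text \<open>
  The groups \<open>F V\<close> may have arbitrary different (even overlapping) carriers inside the type
  \<open>'g\<close>. The map \<open>\<rho> U V\<close> is the restriction from \<open>U\<close> to \<open>V\<close>; it is relevant only for
  open \<open>V \<subseteq> U\<close>.
\<close>

locale abelian_presheaf =
  fixes X :: "'a topology"
    and F :: "'a set \<Rightarrow> ('g, 'm) monoid_scheme"
    and \<rho> :: "'a set \<Rightarrow> 'a set \<Rightarrow> 'g \<Rightarrow> 'g"
  assumes comm_group_sections: "openin X U \<Longrightarrow> comm_group (F U)"
    and restriction_hom:
      "\<lbrakk>openin X U; openin X V; V \<subseteq> U\<rbrakk> \<Longrightarrow> \<rho> U V \<in> hom (F U) (F V)"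
    and restriction_id: "\<lbrakk>openin X U; x \<in> carrier (F U)\<rbrakk> \<Longrightarrow> \<rho> U U x = x"
    and restriction_comp:
      "\<lbrakk>openin X U; openin X V; openin X W; W \<subseteq> V; V \<subseteq> U; x \<in> carrier (F U)\<rbrakk>
        \<Longrightarrow> \<rho> V W (\<rho> U V x) = \<rho> U W x"

section \<open>Cochain complexes and homotopy equivalences\<close>

record 'c cochain_data =
  cochains :: "nat \<Rightarrow> 'c monoid"
  codiff :: "nat \<Rightarrow> 'c \<Rightarrow> 'c"

definition cochain_complex :: "'c cochain_data \<Rightarrow> bool" where
  "cochain_complex C \<longleftrightarrow>
     (\<forall>n. comm_group (cochains C n)) \<and>
     (\<forall>n. codiff C n \<in> hom (cochains C n) (cochains C (Suc n))) \<and>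
     (\<forall>n. \<forall>x\<in>carrier (cochains C n).
        codiff C (Suc n) (codiff C n x) = \<one>\<^bsub>cochains C (Suc (Suc n))\<^esub>)"

definition cochain_map ::
    "'c cochain_data \<Rightarrow> 'd cochain_data \<Rightarrow> (nat \<Rightarrow> 'c \<Rightarrow> 'd) \<Rightarrow> bool" where
  "cochain_map C D f \<longleftrightarrow>
     cochain_complex C \<and> cochain_complex D \<and>
     (\<forall>n. f n \<in> hom (cochains C n) (cochains D n)) \<and>
     (\<forall>n. \<forall>x\<in>carrier (cochains C n). f (Suc n) (codiff C n x) = codiff D n (f n x))"

text \<open>
  The component \<open>h n\<close> of a homotopy goes from degree \<open>n + 1\<close> to degree \<open>n\<close>. The complexes
  vanish in negative degrees, so in degree \<open>0\<close> only the term \<open>h \<circ> \<delta>\<close> remains.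
\<close>

definition cochain_homotopic ::
    "'c cochain_data \<Rightarrow> 'd cochain_data \<Rightarrow> (nat \<Rightarrow> 'c \<Rightarrow> 'd) \<Rightarrow> (nat \<Rightarrow> 'c \<Rightarrow> 'd) \<Rightarrow> bool" where
  "cochain_homotopic C D f g \<longleftrightarrow>
     cochain_map C D f \<and> cochain_map C D g \<and>
     (\<exists>h. (\<forall>n. h n \<in> hom (cochains C (Suc n)) (cochains D n)) \<and>
          (\<forall>x\<in>carrier (cochains C 0).
             f 0 x \<otimes>\<^bsub>cochains D 0\<^esub> inv\<^bsub>cochains D 0\<^esub> (g 0 x) = h 0 (codiff C 0 x)) \<and>
          (\<forall>n. \<forall>x\<in>carrier (cochains C (Suc n)).
             f (Suc n) x \<otimes>\<^bsub>cochains D (Suc n)\<^esub> inv\<^bsub>cochains D (Suc n)\<^esub> (g (Suc n) x) =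
             codiff D n (h n x) \<otimes>\<^bsub>cochains D (Suc n)\<^esub> h (Suc n) (codiff C (Suc n) x)))"

definition cochain_homotopy_equivalence ::
    "'c cochain_data \<Rightarrow> 'd cochain_data \<Rightarrow> (nat \<Rightarrow> 'c \<Rightarrow> 'd) \<Rightarrow> bool" where
  "cochain_homotopy_equivalence C D f \<longleftrightarrow>
     cochain_map C D f \<and>
     (\<exists>g. cochain_map D C g \<and>
          cochain_homotopic C C (\<lambda>n. g n \<circ> f n) (\<lambda>n. id) \<and>
          cochain_homotopic D D (\<lambda>n. f n \<circ> g n) (\<lambda>n. id))"

section \<open>The two complexes of a covering\<close>

definition open_covering :: "'a topology \<Rightarrow> 'a set set \<Rightarrow> bool" where
  "open_covering X \<U> \<longleftrightarrow> (\<forall>U\<in>\<U>. openin X U) \<and> \<Union>\<U> = topspace X"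

text \<open>
  Objects of \<open>\<A>(\<U>)\<close>: the intersections are non-empty as sets, and they are indexed by
  non-empty finite subfamilies (so the whole space, as the intersection of the empty family,
  is not included by convention).
\<close>

definition finite_intersections :: "'a set set \<Rightarrow> 'a set set" where
  "finite_intersections \<U> = {\<Inter>S | S. S \<subseteq> \<U> \<and> finite S \<and> S \<noteq> {} \<and> \<Inter>S \<noteq> {}}"

text \<open>A sequence with entries \<open>0, \<dots>, n\<close> is a list of length \<open>n + 1\<close>.\<close>

definition omit :: "nat \<Rightarrow> 'b list \<Rightarrow> 'b list" where
  "omit i xs = take i xs @ drop (Suc i) xs"

definition cech_nerve :: "'a set set \<Rightarrow> nat \<Rightarrow> 'a set list set" where
  "cech_nerve \<U> n = {us. length us = Suc n \<and> set us \<subseteq> \<U> \<and> \<Inter>(set us) \<noteq> {}}"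

definition category_nerve :: "'a set set \<Rightarrow> nat \<Rightarrow> 'a set list set" where
  "category_nerve \<U> n =
     {vs. length vs = Suc n \<and> set vs \<subseteq> finite_intersections \<U> \<and> sorted_wrt (\<subseteq>) vs}"

definition cech_complex ::
    "'a set set \<Rightarrow> ('a set \<Rightarrow> ('g, 'm) monoid_scheme) \<Rightarrow> ('a set \<Rightarrow> 'a set \<Rightarrow> 'g \<Rightarrow> 'g) \<Rightarrow>
     ('a set list \<Rightarrow> 'g) cochain_data" where
  "cech_complex \<U> F \<rho> =
     \<lparr>cochains = (\<lambda>n. product_group (cech_nerve \<U> n) (\<lambda>us. F (\<Inter>(set us)))),
      codiff = (\<lambda>n c. \<lambda>us\<in>cech_nerve \<U> (Suc n).
        \<Otimes>\<^bsub>F (\<Inter>(set us))\<^esub>i\<in>{..Suc n}.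
          \<rho> (\<Inter>(set (omit i us))) (\<Inter>(set us)) (c (omit i us))
            [^]\<^bsub>F (\<Inter>(set us))\<^esub> ((-1) ^ i :: int))\<rparr>"

text \<open>
  Since \<^term>\<open>hd (omit i vs) = hd vs\<close> for \<open>i > 0\<close>, the restriction below is the identity
  except possibly for \<open>i = 0\<close>.
\<close>

definition category_complex ::
    "'a set set \<Rightarrow> ('a set \<Rightarrow> ('g, 'm) monoid_scheme) \<Rightarrow> ('a set \<Rightarrow> 'a set \<Rightarrow> 'g \<Rightarrow> 'g) \<Rightarrow>
     ('a set list \<Rightarrow> 'g) cochain_data" where
  "category_complex \<U> F \<rho> =
     \<lparr>cochains = (\<lambda>n. product_group (category_nerve \<U> n) (\<lambda>vs. F (hd vs))),
      codiff = (\<lambda>n c. \<lambda>vs\<in>category_nerve \<U> (Suc n).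
        \<Otimes>\<^bsub>F (hd vs)\<^esub>i\<in>{..Suc n}.
          \<rho> (hd (omit i vs)) (hd vs) (c (omit i vs)) [^]\<^bsub>F (hd vs)\<^esub> ((-1) ^ i :: int))\<rparr>"

definition nerve_pullback ::
    "'a set set \<Rightarrow> ('a set \<Rightarrow> 'a set \<Rightarrow> 'g \<Rightarrow> 'g) \<Rightarrow> ('a set \<Rightarrow> 'a set) \<Rightarrow>
     nat \<Rightarrow> ('a set list \<Rightarrow> 'g) \<Rightarrow> ('a set list \<Rightarrow> 'g)" where
  "nerve_pullback \<U> \<rho> \<pi> n c =
     (\<lambda>vs\<in>category_nerve \<U> n. \<rho> (\<Inter>(set (map \<pi> vs))) (hd vs) (c (map \<pi> vs)))"

end

theory Submission
  imports Defs "HOL-Library.Poly_Mapping"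
begin

text \<open>
  A map sending each index \<open>s\<close> to an integral chain of indices \<open>t\<close>, all of whose open sets contain
  that of \<open>s\<close>, acts contravariantly on cochains by restriction; thus chain maps and chain
  homotopies induce cochain maps and cochain homotopies, and everything follows from acyclic
  carriers. Attach to \<open>(U\<^sub>0, \<dots>, U\<^sub>n)\<close> the set \<open>W = U\<^sub>0 \<inter> \<dots> \<inter> U\<^sub>n\<close>, and to
  \<open>V\<^sub>0 \<subseteq> \<dots> \<subseteq> V\<^sub>n\<close> the set \<open>W = V\<^sub>0\<close>. The simplices of either nerve whose set contains
  \<open>W\<close> form a cone, with apex \<open>\<pi> W\<close> in the nerve of the covering and \<open>W\<close> in the nerve of the
  category. Recursion along these cones yields a chain-level inverse of \<open>\<pi>\<close> (a barycentric
  subdivision), and homotopies from both composites to the identities.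
\<close>

section \<open>Integral chains of lists\<close>

type_synonym 'b chain = "'b list \<Rightarrow>\<^sub>0 int"

text \<open>
  The complex is augmented: \<open>boundary [v]\<close> is \<open>frag_of []\<close>, not \<open>0\<close>. This makes \<open>boundary_Cons\<close>
  and the constructions by cones uniform in all degrees.
\<close>

definition boundary :: "'b list \<Rightarrow> 'b chain" where
  "boundary s = (\<Sum>i<length s. frag_cmul ((-1) ^ i) (frag_of (omit i s)))"

definition cone :: "'b \<Rightarrow> 'b chain \<Rightarrow> 'b chain" where
  "cone v = frag_extend (\<lambda>s. frag_of (v # s))"

section \<open>Faces, boundaries and cones of chains\<close>

lemma length_omit: "i < length s \<Longrightarrow> length (omit i s) = length s - 1"
  by (simp add: omit_def)

lemma omit_map: "omit i (map f s) = map f (omit i s)"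
  by (simp add: omit_def take_map drop_map)

lemma set_omit_subset: "set (omit i s) \<subseteq> set s"
  using set_take_subset set_drop_subset by (fastforce simp: omit_def)

lemma boundary_Nil [simp]: "boundary [] = 0"
  by (simp add: boundary_def)

lemma cone_simps [simp]:
  "cone v 0 = 0" "cone v (frag_of s) = frag_of (v # s)"
  "cone v (a + b) = cone v a + cone v b" "cone v (a - b) = cone v a - cone v b"
  by (simp_all add: cone_def frag_extend_add frag_extend_diff)

text \<open>Omitting entry 0 leaves \<open>s\<close>, while omitting entry \<open>Suc i\<close> of
  \<open>v # s\<close> keeps \<open>v\<close> in front and flips the sign. This recursion on lists
  replaces the simplicial identities; \<open>boundary_cone\<close> and
  \<open>boundary_boundary\<close> follow from it.\<close>

lemma boundary_Cons: "boundary (v # s) = frag_of s - cone v (boundary s)"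
proof -
  have "boundary (v # s) =
      frag_of s + (\<Sum>i<length s. frag_cmul (- ((-1) ^ i)) (frag_of (v # omit i s)))"
    unfolding boundary_def length_Cons sum.lessThan_Suc_shift by (simp add: omit_def)
  also have "(\<Sum>i<length s. frag_cmul (- ((-1) ^ i)) (frag_of (v # omit i s))) = - cone v (boundary s)"
    by (simp add: boundary_def cone_def frag_extend_sum frag_extend_cmul sum_negf[symmetric])
  finally show ?thesis by simp
qed

lemma keys_cone: "Poly_Mapping.keys (cone v a) \<subseteq> Cons v ` Poly_Mapping.keys a"
  unfolding cone_def using keys_frag_extend by fastforce

lemma keys_boundary: "Poly_Mapping.keys (boundary s) \<subseteq> (\<lambda>i. omit i s) ` {..<length s}"
proof -
  have "Poly_Mapping.keys (boundary s) \<subseteq>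
      (\<Union>i<length s. Poly_Mapping.keys (frag_cmul ((-1) ^ i) (frag_of (omit i s))))"
    unfolding boundary_def by (rule keys_sum)
  then show ?thesis by auto
qed

lemma keys_frag_extend_subset:
  assumes "\<And>s. s \<in> Poly_Mapping.keys a \<Longrightarrow> Poly_Mapping.keys (\<phi> s) \<subseteq> T"
  shows "Poly_Mapping.keys (frag_extend \<phi> a) \<subseteq> T"
  using assms keys_frag_extend[of \<phi> a] by blast

lemma frag_extend_frag_extend:
  "frag_extend f (frag_extend g a) = frag_extend (\<lambda>s. frag_extend f (g s)) a"
proof -
  have "Poly_Mapping.keys a \<subseteq> UNIV" by simp
  then show ?thesis
    by (induction a rule: frag_induction) (simp_all add: frag_extend_diff)
qed

lemma frag_extend_minus_fun:
  "frag_extend (\<lambda>s. f s - g s) a = frag_extend f a - frag_extend g a"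
proof -
  have "Poly_Mapping.keys a \<subseteq> UNIV" by simp
  then show ?thesis
    by (induction a rule: frag_induction) (simp_all add: frag_extend_diff)
qed

text \<open>By linearity from \<open>boundary_Cons\<close>. Coning is a contracting homotopy of the
  augmented complex, so a cycle \<open>a\<close> is the boundary of \<open>cone v a\<close>; both
  recursive constructions below rest on this.\<close>

lemma boundary_cone: "frag_extend boundary (cone v a) = a - cone v (frag_extend boundary a)"
proof -
  have "Poly_Mapping.keys a \<subseteq> UNIV" by simp
  then show ?thesis
    by (induction a rule: frag_induction)
      (simp_all add: frag_extend_diff boundary_Cons)
qed

text \<open>For \<open>v # s\<close> the two copies of \<open>boundary s\<close> cancel, leaving a
  cone over the double boundary of \<open>s\<close>, which vanishes by induction.\<close>

lemma boundary_boundary [simp]: "frag_extend boundary (boundary s) = 0"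
  by (induction s) (simp_all add: boundary_Cons frag_extend_diff boundary_cone)

lemma frag_extend_boundary:
  "frag_extend \<phi> (boundary s) = (\<Sum>i<length s. frag_cmul ((-1) ^ i) (\<phi> (omit i s)))"
  by (simp add: boundary_def frag_extend_sum frag_extend_cmul)

subsection \<open>Chain maps and homotopies built from cones\<close>

text \<open>\<open>\<phi>\<close> gives the values on basis lists, and
  \<open>frag_extend \<phi>\<close> is the chain map itself. The clause for \<open>[]\<close> is
  preservation of the augmentation. Degrees are left to \<open>carried\<close>.\<close>

definition is_chain_map :: "('b list \<Rightarrow> 'c chain) \<Rightarrow> bool" where
  "is_chain_map \<phi> \<longleftrightarrow> \<phi> [] = frag_of [] \<and>
     (\<forall>s. frag_extend boundary (\<phi> s) = frag_extend \<phi> (boundary s))"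

lemma is_chain_map_compose:
  assumes "is_chain_map \<phi>" "is_chain_map \<psi>"
  shows "is_chain_map (\<lambda>s. frag_extend \<psi> (\<phi> s))"
proof -
  have "frag_extend boundary (frag_extend \<psi> (\<phi> s)) =
      frag_extend (\<lambda>s. frag_extend \<psi> (\<phi> s)) (boundary s)" for s
  proof -
    have "frag_extend boundary (frag_extend \<psi> (\<phi> s)) =
        frag_extend (\<lambda>t. frag_extend \<psi> (boundary t)) (\<phi> s)"
      using assms by (simp add: frag_extend_frag_extend is_chain_map_def)
    also have "\<dots> = frag_extend \<psi> (frag_extend boundary (\<phi> s))"
      by (simp add: frag_extend_frag_extend)
    also have "\<dots> = frag_extend (\<lambda>s. frag_extend \<psi> (\<phi> s)) (boundary s)"
      using assms by (simp add: frag_extend_frag_extend is_chain_map_def)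
    finally show ?thesis .
  qed
  with assms show ?thesis by (simp add: is_chain_map_def)
qed

lemma is_chain_map_frag_of: "is_chain_map frag_of"
  by (simp add: is_chain_map_def flip: frag_expansion)

lemma is_chain_map_map: "is_chain_map (\<lambda>s. frag_of (map f s))"
  unfolding is_chain_map_def frag_extend_boundary
  by (simp add: boundary_def omit_map)

text \<open>The sum is \<open>frag_extend (cone_map v) (boundary s)\<close> written out, so that the
  recursive calls on shorter lists are visible to the termination proof.\<close>

function cone_map :: "('b list \<Rightarrow> 'c) \<Rightarrow> 'b list \<Rightarrow> 'c chain" where
  "cone_map v s = (if s = [] then frag_of []
     else cone (v s) (\<Sum>i<length s. frag_cmul ((-1) ^ i) (cone_map v (omit i s))))"
  by auto
termination by (relation "measure (length \<circ> snd)") (auto simp: length_omit)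

text \<open>The homotopy identity prescribes the boundary of the value at \<open>s\<close> as
  \<open>D s\<close> minus the homotopy on the faces. Coning off this chain from \<open>v s\<close>
  solves the equation whenever the chain is a cycle.\<close>

function cone_homotopy :: "('b list \<Rightarrow> 'c) \<Rightarrow> ('b list \<Rightarrow> 'c chain) \<Rightarrow> 'b list \<Rightarrow> 'c chain" where
  "cone_homotopy v D s = (if s = [] then 0
     else cone (v s) (D s - (\<Sum>i<length s. frag_cmul ((-1) ^ i) (cone_homotopy v D (omit i s)))))"
  by auto
termination by (relation "measure (length \<circ> snd \<circ> snd)") (auto simp: length_omit)

declare cone_map.simps [simp del] cone_homotopy.simps [simp del]

lemma cone_map_Nil [simp]: "cone_map v [] = frag_of []"
  and cone_map_nonempty:
    "s \<noteq> [] \<Longrightarrow> cone_map v s = cone (v s) (frag_extend (cone_map v) (boundary s))"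
  by (simp_all add: cone_map.simps[of v] frag_extend_boundary)

lemma cone_homotopy_Nil [simp]: "cone_homotopy v D [] = 0"
  and cone_homotopy_nonempty:
    "s \<noteq> [] \<Longrightarrow>
      cone_homotopy v D s = cone (v s) (D s - frag_extend (cone_homotopy v D) (boundary s))"
  by (simp_all add: cone_homotopy.simps[of v] frag_extend_boundary)

lemma length_keys_boundary: "t \<in> Poly_Mapping.keys (boundary s) \<Longrightarrow> length t < length s"
  using keys_boundary[of s] by (force simp: length_omit)

text \<open>The cone has the required boundary once
  \<open>frag_extend (cone_map v) (boundary s)\<close> is a cycle. The faces of \<open>s\<close> are
  shorter, so by induction its boundary is the image of the double boundary of \<open>s\<close>,
  which is zero.\<close>

lemma is_chain_map_cone_map: "is_chain_map (cone_map v)"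
proof -
  have "frag_extend boundary (cone_map v s) = frag_extend (cone_map v) (boundary s)" for s
  proof (induction s rule: length_induct)
    case (1 s)
    show ?case
    proof (cases "s = []")
      case False
      have "frag_extend boundary (frag_extend (cone_map v) (boundary s)) =
          frag_extend (\<lambda>t. frag_extend (cone_map v) (boundary t)) (boundary s)"
        unfolding frag_extend_frag_extend
        by (rule frag_extend_eq) (use 1 length_keys_boundary in blast)
      also have "\<dots> = frag_extend (cone_map v) (frag_extend boundary (boundary s))"
        by (simp only: frag_extend_frag_extend)
      finally show ?thesis
        using False by (simp add: cone_map_nonempty boundary_cone)
    qed simp
  qed
  then show ?thesis by (simp add: is_chain_map_def)
qed

text \<open>By induction on the faces and because \<open>\<phi>\<close> and \<open>\<psi>\<close>
  are chain maps, \<open>h\<close> and \<open>\<phi> s - \<psi> s\<close> have the same boundary.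
  Their difference is a cycle, hence the boundary of its cone.\<close>

lemma cone_homotopy:
  fixes v :: "'b list \<Rightarrow> 'c"
  assumes \<phi>: "is_chain_map \<phi>" and \<psi>: "is_chain_map \<psi>"
  defines "H \<equiv> cone_homotopy v (\<lambda>s. \<phi> s - \<psi> s)"
  shows "frag_extend boundary (H s) + frag_extend H (boundary s) = \<phi> s - \<psi> s"
proof (induction s rule: length_induct)
  case (1 s)
  show ?case
  proof (cases "s = []")
    case True
    with \<phi> \<psi> show ?thesis by (simp add: H_def is_chain_map_def)
  next
    case False
    define h where "h = frag_extend H (boundary s)"
    have "frag_extend boundary h = frag_extend (\<lambda>t. \<phi> t - \<psi> t - frag_extend H (boundary t)) (boundary s)"
      unfolding h_def frag_extend_frag_extend
      by (rule frag_extend_eq) (use 1 length_keys_boundary in \<open>auto simp: algebra_simps\<close>)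
    \<comment> \<open>The terms \<open>frag_extend H (boundary t)\<close> add up to the image of the
      double boundary of \<open>s\<close>, which is zero.\<close>
    also have "\<dots> = frag_extend \<phi> (boundary s) - frag_extend \<psi> (boundary s)"
      by (simp add: frag_extend_minus_fun flip: frag_extend_frag_extend)
    finally have "frag_extend boundary (\<phi> s - \<psi> s - h) = 0"
      using \<phi> \<psi> by (simp add: frag_extend_diff is_chain_map_def)
    moreover have "H s = cone (v s) (\<phi> s - \<psi> s - h)"
      using False by (simp add: H_def h_def cone_homotopy_nonempty)
    ultimately show ?thesis
      by (simp add: boundary_cone flip: h_def del: cone_simps(4))
  qed
qed

section \<open>Evaluating chains in an abelian group\<close>

context comm_group
begin

text \<open>The homomorphism from the free abelian group extending \<open>x\<close>. The lemmas ask
  for \<open>x t \<in> carrier G\<close> only on supports, since later \<open>x t\<close> is a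
  restriction that makes sense only for those \<open>t\<close>.\<close>

definition frag_eval :: "('i \<Rightarrow> 'a) \<Rightarrow> ('i \<Rightarrow>\<^sub>0 int) \<Rightarrow> 'a" where
  "frag_eval x a = (\<Otimes>t\<in>Poly_Mapping.keys a. x t [^] Poly_Mapping.lookup a t)"

lemma frag_eval_superset:
  assumes "finite A" "Poly_Mapping.keys a \<subseteq> A" "x \<in> A \<rightarrow> carrier G"
  shows "frag_eval x a = (\<Otimes>t\<in>A. x t [^] Poly_Mapping.lookup a t)"
  unfolding frag_eval_def
  by (rule finprod_mono_neutral_cong_left) (use assms in \<open>auto simp: in_keys_iff\<close>)

lemma frag_eval_closed [simp]:
  "x \<in> Poly_Mapping.keys a \<rightarrow> carrier G \<Longrightarrow> frag_eval x a \<in> carrier G"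
  by (auto simp: frag_eval_def intro!: finprod_closed)

lemma frag_eval_cong:
  assumes "\<And>t. t \<in> Poly_Mapping.keys a \<Longrightarrow> x t = y t" "y \<in> Poly_Mapping.keys a \<rightarrow> carrier G"
  shows "frag_eval x a = frag_eval y a"
  unfolding frag_eval_def by (rule finprod_cong') (use assms in auto)

lemma frag_eval_0 [simp]: "frag_eval x 0 = \<one>"
  by (simp add: frag_eval_def)

lemma frag_eval_of [simp]: "x t \<in> carrier G \<Longrightarrow> frag_eval x (frag_of t) = x t"
  by (simp add: frag_eval_def)

lemma frag_eval_add:
  assumes "x \<in> Poly_Mapping.keys a \<union> Poly_Mapping.keys b \<rightarrow> carrier G"
  shows "frag_eval x (a + b) = frag_eval x a \<otimes> frag_eval x b"
proof -
  let ?A = "Poly_Mapping.keys a \<union> Poly_Mapping.keys b"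
  have "frag_eval x c = (\<Otimes>t\<in>?A. x t [^] Poly_Mapping.lookup c t)"
    if "Poly_Mapping.keys c \<subseteq> ?A" for c
    using that assms by (intro frag_eval_superset) auto
  note eval = this
  have "frag_eval x (a + b) =
      (\<Otimes>t\<in>?A. x t [^] Poly_Mapping.lookup a t \<otimes> x t [^] Poly_Mapping.lookup b t)"
    unfolding eval[OF Poly_Mapping.keys_add]
    by (rule finprod_cong') (use assms in \<open>auto simp: lookup_add int_pow_mult Pi_iff\<close>)
  also have "\<dots> = frag_eval x a \<otimes> frag_eval x b"
    using assms by (subst finprod_multf) (auto simp: eval)
  finally show ?thesis .
qed

lemma frag_eval_diff:
  assumes "x \<in> Poly_Mapping.keys a \<union> Poly_Mapping.keys b \<rightarrow> carrier G"
  shows "frag_eval x (a - b) = frag_eval x a \<otimes> inv (frag_eval x b)"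
proof -
  have "x \<in> Poly_Mapping.keys (a - b) \<rightarrow> carrier G"
    using assms keys_diff[of a b] by blast
  moreover have "frag_eval x a = frag_eval x (a - b) \<otimes> frag_eval x b"
    using assms keys_diff[of a b] frag_eval_add[of x "a - b" b] by fastforce
  ultimately show ?thesis
    using assms by (auto simp: m_assoc)
qed

lemma frag_eval_sum:
  assumes "finite I" "\<And>i. i \<in> I \<Longrightarrow> x \<in> Poly_Mapping.keys (a i) \<rightarrow> carrier G"
  shows "frag_eval x (sum a I) = (\<Otimes>i\<in>I. frag_eval x (a i))"
  using assms
proof (induction I)
  case (insert i I)
  have "x \<in> Poly_Mapping.keys (a i) \<union> Poly_Mapping.keys (sum a I) \<rightarrow> carrier G"
    using insert.prems keys_sum[of a I] by blast
  then have "frag_eval x (sum a (insert i I)) = frag_eval x (a i) \<otimes> frag_eval x (sum a I)"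
    using insert.hyps by (simp add: frag_eval_add)
  also have "\<dots> = (\<Otimes>i\<in>insert i I. frag_eval x (a i))"
    using insert by (subst finprod_insert) (auto simp: frag_eval_def intro!: finprod_closed)
  finally show ?case .
qed simp

lemma frag_eval_signed_of:
  assumes "x t \<in> carrier G"
  shows "frag_eval x (frag_cmul ((-1) ^ i) (frag_of t)) = x t [^] ((-1) ^ i :: int)"
proof -
  have "frag_cmul ((-1) ^ i) (frag_of t) = (if even i then frag_of t else 0 - frag_of t)"
    by simp
  with assms show ?thesis
    using frag_eval_diff[of x 0 "frag_of t"] int_pow_neg[of "x t" 1] by (auto simp del: diff_0)
qed

lemma frag_eval_boundary:
  assumes "\<And>i. i < length s \<Longrightarrow> x (omit i s) \<in> carrier G"
  shows "frag_eval x (boundary s) = (\<Otimes>i\<in>{..<length s}. x (omit i s) [^] ((-1) ^ i :: int))"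
proof -
  have "frag_eval x (boundary s) =
      (\<Otimes>i\<in>{..<length s}. frag_eval x (frag_cmul ((-1) ^ i) (frag_of (omit i s))))"
    unfolding boundary_def by (rule frag_eval_sum) (use assms in auto)
  also have "\<dots> = (\<Otimes>i\<in>{..<length s}. x (omit i s) [^] ((-1) ^ i :: int))"
    by (rule finprod_cong') (use assms in \<open>auto simp: frag_eval_signed_of\<close>)
  finally show ?thesis .
qed

lemma frag_eval_mult:
  assumes "x \<in> Poly_Mapping.keys a \<rightarrow> carrier G" "y \<in> Poly_Mapping.keys a \<rightarrow> carrier G"
  shows "frag_eval (\<lambda>t. x t \<otimes> y t) a = frag_eval x a \<otimes> frag_eval y a"
proof -
  have "frag_eval (\<lambda>t. x t \<otimes> y t) a =
      (\<Otimes>t\<in>Poly_Mapping.keys a. x t [^] Poly_Mapping.lookup a t \<otimes> y t [^] Poly_Mapping.lookup a t)"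
    unfolding frag_eval_def by (rule finprod_cong') (use assms in \<open>auto simp: int_pow_distrib Pi_iff\<close>)
  also have "\<dots> = frag_eval x a \<otimes> frag_eval y a"
    unfolding frag_eval_def by (rule finprod_multf) (use assms in auto)
  finally show ?thesis .
qed

lemma frag_eval_frag_extend:
  assumes "\<And>s. s \<in> Poly_Mapping.keys a \<Longrightarrow> x \<in> Poly_Mapping.keys (\<phi> s) \<rightarrow> carrier G"
  shows "frag_eval x (frag_extend \<phi> a) = frag_eval (\<lambda>s. frag_eval x (\<phi> s)) a"
proof -
  \<comment> \<open>\<open>S\<close> freezes the original support. The difference step of
    \<open>frag_induction\<close> records no supports of its two parts, so the support bound is
    carried along as a conjunct.\<close>
  define S where "S = Poly_Mapping.keys a"
  have "Poly_Mapping.keys a \<subseteq> S" by (simp add: S_def)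
  then have "Poly_Mapping.keys a \<subseteq> S \<and>
      frag_eval x (frag_extend \<phi> a) = frag_eval (\<lambda>s. frag_eval x (\<phi> s)) a"
  proof (induction a rule: frag_induction)
    case (one s)
    with assms show ?case by (simp add: S_def)
  next
    case (diff b c)
    have ext: "x \<in> Poly_Mapping.keys (frag_extend \<phi> d) \<rightarrow> carrier G"
      if "Poly_Mapping.keys d \<subseteq> S" for d
      using that assms keys_frag_extend[of \<phi> d] unfolding S_def by blast
    have "Poly_Mapping.keys (b - c) \<subseteq> S"
      using diff keys_diff[of b c] by blast
    moreover have "frag_eval x (frag_extend \<phi> (b - c)) = frag_eval (\<lambda>s. frag_eval x (\<phi> s)) (b - c)"
    proof -
      have "(\<lambda>s. frag_eval x (\<phi> s)) \<in> Poly_Mapping.keys b \<union> Poly_Mapping.keys c \<rightarrow> carrier G"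
        using diff assms by (auto simp: S_def intro!: frag_eval_closed)
      moreover have "x \<in> Poly_Mapping.keys (frag_extend \<phi> b) \<union> Poly_Mapping.keys (frag_extend \<phi> c)
          \<rightarrow> carrier G"
        using diff ext[of b] ext[of c] by blast
      ultimately show ?thesis
        using diff by (simp add: frag_extend_diff frag_eval_diff)
    qed
    ultimately show ?case by blast
  qed simp
  then show ?thesis by blast
qed

end

text \<open>Both sides are additive in \<open>a\<close> and agree on generators. It is applied to
  restriction maps in \<open>pull_pull\<close>.\<close>

lemma hom_frag_eval:
  fixes a :: "'i \<Rightarrow>\<^sub>0 int"
  assumes "comm_group G" "comm_group H" and h: "h \<in> hom G H"
    and x: "x \<in> Poly_Mapping.keys a \<rightarrow> carrier G"
  shows "h (comm_group.frag_eval G x a) = comm_group.frag_eval H (\<lambda>t. h (x t)) a"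
proof -
  interpret G: comm_group G by fact
  interpret H: comm_group H by fact
  interpret h: group_hom G H h by unfold_locales (fact h)
  define S where "S = Poly_Mapping.keys a"
  have "Poly_Mapping.keys a \<subseteq> S" by (simp add: S_def)
  then have "Poly_Mapping.keys a \<subseteq> S \<and> h (G.frag_eval x a) = H.frag_eval (\<lambda>t. h (x t)) a"
  proof (induction a rule: frag_induction)
    case (one s)
    with x have "x s \<in> carrier G" by (auto simp: S_def)
    with one show ?case by simp
  next
    case (diff b c)
    have cl: "x \<in> Poly_Mapping.keys d \<rightarrow> carrier G"
      if "Poly_Mapping.keys d \<subseteq> S" for d :: "'i \<Rightarrow>\<^sub>0 int"
      using that x unfolding S_def by blast
    have "Poly_Mapping.keys (b - c) \<subseteq> S"
      using diff keys_diff[of b c] by blast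
    moreover have "h (G.frag_eval x (b - c)) = H.frag_eval (\<lambda>t. h (x t)) (b - c)"
    proof -
      have x_bc: "x \<in> Poly_Mapping.keys b \<union> Poly_Mapping.keys c \<rightarrow> carrier G"
        using diff cl[of b] cl[of c] by blast
      then have "(\<lambda>t. h (x t)) \<in> Poly_Mapping.keys b \<union> Poly_Mapping.keys c \<rightarrow> carrier H"
        by (auto simp: Pi_iff)
      with x_bc show ?thesis
        using diff by (simp add: G.frag_eval_diff H.frag_eval_diff)
    qed
    ultimately show ?case by blast
  qed simp
  then show ?thesis by blast
qed

section \<open>Chains acting on cochains\<close>

lemma comm_group_product_group:
  assumes "\<And>i. i \<in> I \<Longrightarrow> comm_group (G i)"
  shows "comm_group (product_group I G)"
proof (rule group.group_comm_groupI)
  show "group (product_group I G)"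
    using assms by (simp add: comm_group.axioms)
  show "x \<otimes>\<^bsub>product_group I G\<^esub> y = y \<otimes>\<^bsub>product_group I G\<^esub> x"
    if "x \<in> carrier (product_group I G)" "y \<in> carrier (product_group I G)" for x y
    using that assms by (auto simp: PiE_iff comm_groupE(4) intro!: restrict_ext)
qed

section \<open>Independence of values off the carriers\<close>

lemma codiff_closed:
  assumes "cochain_complex C" "x \<in> carrier (cochains C n)"
  shows "codiff C n x \<in> carrier (cochains C (Suc n))"
  using assms by (auto simp: cochain_complex_def dest: hom_in_carrier)

lemma cochain_map_cong:
  assumes "cochain_map C D f"
    and f': "\<And>n x. x \<in> carrier (cochains C n) \<Longrightarrow> f' n x = f n x"
  shows "cochain_map C D f'"
proof -
  have "comm_group (cochains C n)" for n
    using assms by (auto simp: cochain_map_def cochain_complex_def)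
  moreover have "codiff C n x \<in> carrier (cochains C (Suc n))"
    if "x \<in> carrier (cochains C n)" for n x
    using assms that by (auto simp: cochain_map_def intro: codiff_closed)
  ultimately show ?thesis
    using assms by (auto simp: cochain_map_def hom_def Pi_iff comm_groupE(1))
qed

lemma cochain_homotopic_cong:
  assumes "cochain_homotopic C D f g"
    and f: "\<And>n x. x \<in> carrier (cochains C n) \<Longrightarrow> f' n x = f n x"
    and g: "\<And>n x. x \<in> carrier (cochains C n) \<Longrightarrow> g' n x = g n x"
  shows "cochain_homotopic C D f' g'"
proof -
  have "cochain_map C D f'" "cochain_map C D g'"
    using assms by (auto simp: cochain_homotopic_def intro: cochain_map_cong)
  then show ?thesis
    using assms unfolding cochain_homotopic_def by simp
qed

text \<open>All maps are evaluated on cochains only, and \<open>g\<close> sends cochains to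
  cochains. Such congruence rules are needed because identifications like \<open>pull_id\<close> and
  \<open>pull_frag_of\<close> hold only on carriers.\<close>

lemma cochain_homotopy_equivalence_cong:
  assumes "cochain_homotopy_equivalence C D f"
    and f': "\<And>n x. x \<in> carrier (cochains C n) \<Longrightarrow> f' n x = f n x"
  shows "cochain_homotopy_equivalence C D f'"
proof -
  obtain g where f: "cochain_map C D f" and g: "cochain_map D C g"
    and gf: "cochain_homotopic C C (\<lambda>n. g n \<circ> f n) (\<lambda>n. id)"
    and fg: "cochain_homotopic D D (\<lambda>n. f n \<circ> g n) (\<lambda>n. id)"
    using assms(1) by (auto simp: cochain_homotopy_equivalence_def)
  have "g n y \<in> carrier (cochains C n)" if "y \<in> carrier (cochains D n)" for n y
    using g that by (auto simp: cochain_map_def dest: hom_in_carrier)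
  then have "cochain_homotopic D D (\<lambda>n. f' n \<circ> g n) (\<lambda>n. id)"
    using f' by (intro cochain_homotopic_cong[OF fg]) simp_all
  moreover have "cochain_homotopic C C (\<lambda>n. g n \<circ> f' n) (\<lambda>n. id)"
    using f' by (intro cochain_homotopic_cong[OF gf]) simp_all
  ultimately show ?thesis
    using cochain_map_cong[OF f f'] g by (auto simp: cochain_homotopy_equivalence_def)
qed

context abelian_presheaf
begin

text \<open>One operation covers differentials, cochain maps and homotopies, so that identities
  between them reduce to identities of chains.\<close>

definition pull ::
    "'i set \<Rightarrow> ('i \<Rightarrow> 'a set) \<Rightarrow> ('j \<Rightarrow> 'a set) \<Rightarrow> ('i \<Rightarrow> 'j \<Rightarrow>\<^sub>0 int) \<Rightarrow> ('j \<Rightarrow> 'g) \<Rightarrow> 'i \<Rightarrow> 'g" where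
  "pull I A B \<phi> c =
     (\<lambda>s\<in>I. comm_group.frag_eval (F (A s)) (\<lambda>t. \<rho> (B t) (A s) (c t)) (\<phi> s))"

text \<open>The carrier condition of the acyclic carrier method. It also makes every restriction
  from \<open>B t\<close> to \<open>A s\<close> that occurs in \<open>pull\<close> meaningful, which
  is why openness is included.\<close>

definition carried ::
    "'i set \<Rightarrow> ('i \<Rightarrow> 'a set) \<Rightarrow> 'j set \<Rightarrow> ('j \<Rightarrow> 'a set) \<Rightarrow> ('i \<Rightarrow> 'j \<Rightarrow>\<^sub>0 int) \<Rightarrow> bool" where
  "carried I A J B \<phi> \<longleftrightarrow>
     (\<forall>s\<in>I. openin X (A s)) \<and> (\<forall>t\<in>J. openin X (B t)) \<and>
     (\<forall>s\<in>I. Poly_Mapping.keys (\<phi> s) \<subseteq> {t\<in>J. A s \<subseteq> B t})"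

abbreviation sections :: "'i set \<Rightarrow> ('i \<Rightarrow> 'a set) \<Rightarrow> ('i \<Rightarrow> 'g) monoid" where
  "sections I A \<equiv> product_group I (\<lambda>s. F (A s))"

lemma restriction_closed:
  "\<lbrakk>openin X U; openin X V; V \<subseteq> U; x \<in> carrier (F U)\<rbrakk> \<Longrightarrow> \<rho> U V x \<in> carrier (F V)"
  by (rule hom_in_carrier[OF restriction_hom])

lemma carriedD:
  assumes "carried I A J B \<phi>" "s \<in> I"
  shows "openin X (A s)"
    and "t \<in> Poly_Mapping.keys (\<phi> s) \<Longrightarrow> t \<in> J"
    and "t \<in> Poly_Mapping.keys (\<phi> s) \<Longrightarrow> A s \<subseteq> B t"
    and "t \<in> Poly_Mapping.keys (\<phi> s) \<Longrightarrow> openin X (B t)"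
  using assms unfolding carried_def by blast+

lemma restrict_cochain_closed:
  assumes "carried I A J B \<phi>" "s \<in> I" "c \<in> carrier (sections J B)"
  shows "(\<lambda>t. \<rho> (B t) (A s) (c t)) \<in> Poly_Mapping.keys (\<phi> s) \<rightarrow> carrier (F (A s))"
proof
  fix t assume "t \<in> Poly_Mapping.keys (\<phi> s)"
  note t = carriedD[OF assms(1,2)] carriedD(2-4)[OF assms(1,2) this]
  then show "\<rho> (B t) (A s) (c t) \<in> carrier (F (A s))"
    using assms(3) t by (intro restriction_closed) (auto simp: PiE_iff)
qed

lemma carried_diff:
  assumes "carried I A J B \<phi>" "carried I A J B \<psi>"
  shows "carried I A J B (\<lambda>s. \<phi> s - \<psi> s)"
  unfolding carried_def
proof (intro conjI ballI)
  fix s assume "s \<in> I"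
  with assms show "Poly_Mapping.keys (\<phi> s - \<psi> s) \<subseteq> {t \<in> J. A s \<subseteq> B t}"
    using keys_diff[of "\<phi> s" "\<psi> s"] unfolding carried_def by blast
qed (use assms in \<open>auto simp: carried_def\<close>)

lemma carried_compose:
  assumes "carried I A J B \<phi>" "carried J B L D \<psi>"
  shows "carried I A L D (\<lambda>s. frag_extend \<psi> (\<phi> s))"
  unfolding carried_def
proof (intro conjI ballI keys_frag_extend_subset)
  fix s t assume "s \<in> I" "t \<in> Poly_Mapping.keys (\<phi> s)"
  with assms(1) have "t \<in> J" "A s \<subseteq> B t" by (auto dest: carriedD)
  with assms(2) show "Poly_Mapping.keys (\<psi> t) \<subseteq> {u \<in> L. A s \<subseteq> D u}"
    by (fastforce simp: carried_def)
qed (use assms in \<open>auto simp: carried_def\<close>)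

lemma pull_closed:
  assumes "carried I A J B \<phi>" "c \<in> carrier (sections J B)"
  shows "pull I A B \<phi> c \<in> carrier (sections I A)"
proof -
  have "comm_group.frag_eval (F (A s)) (\<lambda>t. \<rho> (B t) (A s) (c t)) (\<phi> s) \<in> carrier (F (A s))"
    if "s \<in> I" for s
  proof -
    interpret comm_group "F (A s)"
      using that assms by (auto simp: carried_def intro: comm_group_sections)
    show ?thesis
      by (rule frag_eval_closed) (rule restrict_cochain_closed[OF assms(1) that assms(2)])
  qed
  then show ?thesis by (simp add: pull_def)
qed

lemma pull_hom:
  assumes \<phi>: "carried I A J B \<phi>"
  shows "pull I A B \<phi> \<in> hom (sections J B) (sections I A)"
proof (rule homI)
  show "pull I A B \<phi> c \<in> carrier (sections I A)" if "c \<in> carrier (sections J B)" for c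
    using \<phi> that by (rule pull_closed)
next
  fix c d
  assume c: "c \<in> carrier (sections J B)" and d: "d \<in> carrier (sections J B)"
  have "pull I A B \<phi> (c \<otimes>\<^bsub>sections J B\<^esub> d) s = pull I A B \<phi> c s \<otimes>\<^bsub>F (A s)\<^esub> pull I A B \<phi> d s"
    if s: "s \<in> I" for s
  proof -
    interpret comm_group "F (A s)"
      using s \<phi> by (auto simp: carried_def intro: comm_group_sections)
    note cl = restrict_cochain_closed[OF \<phi> s c] restrict_cochain_closed[OF \<phi> s d]
    have "frag_eval (\<lambda>t. \<rho> (B t) (A s) ((c \<otimes>\<^bsub>sections J B\<^esub> d) t)) (\<phi> s) =
        frag_eval (\<lambda>t. \<rho> (B t) (A s) (c t) \<otimes>\<^bsub>F (A s)\<^esub> \<rho> (B t) (A s) (d t)) (\<phi> s)"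
    proof (rule frag_eval_cong)
      fix t assume t: "t \<in> Poly_Mapping.keys (\<phi> s)"
      then show "\<rho> (B t) (A s) ((c \<otimes>\<^bsub>sections J B\<^esub> d) t) =
          \<rho> (B t) (A s) (c t) \<otimes>\<^bsub>F (A s)\<^esub> \<rho> (B t) (A s) (d t)"
        using c d hom_mult[OF restriction_hom] carriedD[OF \<phi> s] by (simp add: PiE_iff)
    qed (use cl in auto)
    also have "\<dots> = frag_eval (\<lambda>t. \<rho> (B t) (A s) (c t)) (\<phi> s) \<otimes>\<^bsub>F (A s)\<^esub>
        frag_eval (\<lambda>t. \<rho> (B t) (A s) (d t)) (\<phi> s)"
      using cl by (rule frag_eval_mult)
    finally show ?thesis using s by (simp add: pull_def)
  qed
  then show "pull I A B \<phi> (c \<otimes>\<^bsub>sections J B\<^esub> d) =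
      pull I A B \<phi> c \<otimes>\<^bsub>sections I A\<^esub> pull I A B \<phi> d"
    by (auto simp: pull_def intro!: restrict_ext)
qed

lemma pull_cong:
  assumes "\<And>s. s \<in> I \<Longrightarrow> \<phi> s = \<psi> s"
  shows "pull I A B \<phi> c = pull I A B \<psi> c"
  using assms by (auto simp: pull_def intro!: restrict_ext)

lemma pull_zero:
  assumes "\<And>s. s \<in> I \<Longrightarrow> openin X (A s)" "\<And>s. s \<in> I \<Longrightarrow> \<phi> s = 0"
  shows "pull I A B \<phi> c = \<one>\<^bsub>sections I A\<^esub>"
  using assms by (auto simp: pull_def comm_group.frag_eval_0 comm_group_sections intro!: restrict_ext)

lemma pull_frag_of:
  assumes "carried I A J B (\<lambda>s. frag_of (f s))" "c \<in> carrier (sections J B)"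
  shows "pull I A B (\<lambda>s. frag_of (f s)) c = (\<lambda>s\<in>I. \<rho> (B (f s)) (A s) (c (f s)))"
proof -
  have "comm_group.frag_eval (F (A s)) (\<lambda>t. \<rho> (B t) (A s) (c t)) (frag_of (f s)) =
      \<rho> (B (f s)) (A s) (c (f s))" if "s \<in> I" for s
    using that assms restrict_cochain_closed[OF assms(1) that assms(2)]
    by (subst comm_group.frag_eval_of) (auto simp: carried_def intro: comm_group_sections)
  then show ?thesis by (auto simp: pull_def intro!: restrict_ext)
qed

lemma pull_id:
  assumes "\<And>s. s \<in> I \<Longrightarrow> openin X (A s)" "c \<in> carrier (sections I A)"
  shows "pull I A A frag_of c = c"
proof -
  have "carried I A I A frag_of"
    using assms by (simp add: carried_def)
  from pull_frag_of[OF this assms(2)] show ?thesis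
    using assms by (auto simp: restriction_id PiE_iff extensional_def fun_eq_iff)
qed

lemma pull_add:
  assumes "carried I A J B \<phi>" "carried I A J B \<psi>" "c \<in> carrier (sections J B)"
  shows "pull I A B (\<lambda>s. \<phi> s + \<psi> s) c = pull I A B \<phi> c \<otimes>\<^bsub>sections I A\<^esub> pull I A B \<psi> c"
proof -
  have "comm_group.frag_eval (F (A s)) (\<lambda>t. \<rho> (B t) (A s) (c t)) (\<phi> s + \<psi> s) =
      pull I A B \<phi> c s \<otimes>\<^bsub>F (A s)\<^esub> pull I A B \<psi> c s" if s: "s \<in> I" for s
    using s assms restrict_cochain_closed[OF _ s assms(3)]
    by (subst comm_group.frag_eval_add)
      (auto simp: carried_def pull_def intro!: comm_group_sections)
  then show ?thesis by (auto simp: pull_def intro!: restrict_ext)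
qed

lemma pull_diff:
  assumes "carried I A J B \<phi>" "carried I A J B \<psi>" "c \<in> carrier (sections J B)"
  shows "pull I A B (\<lambda>s. \<phi> s - \<psi> s) c =
    pull I A B \<phi> c \<otimes>\<^bsub>sections I A\<^esub> inv\<^bsub>sections I A\<^esub> (pull I A B \<psi> c)"
proof -
  have grp: "group (F (A s))" if "s \<in> I" for s
    using comm_group_sections[OF carriedD(1)[OF assms(1) that]] by (rule comm_group.axioms(2))
  have "comm_group.frag_eval (F (A s)) (\<lambda>t. \<rho> (B t) (A s) (c t)) (\<phi> s - \<psi> s) =
      pull I A B \<phi> c s \<otimes>\<^bsub>F (A s)\<^esub> inv\<^bsub>F (A s)\<^esub> (pull I A B \<psi> c s)" if s: "s \<in> I" for s
    using s assms restrict_cochain_closed[OF _ s assms(3)]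
    by (subst comm_group.frag_eval_diff)
      (auto simp: carried_def pull_def intro!: comm_group_sections)
  moreover have "inv\<^bsub>sections I A\<^esub> (pull I A B \<psi> c) = (\<lambda>s\<in>I. inv\<^bsub>F (A s)\<^esub> (pull I A B \<psi> c s))"
    using pull_closed[OF assms(2,3)] grp by (intro inv_product_group) auto
  ultimately show ?thesis by (auto simp: pull_def intro!: restrict_ext)
qed

text \<open>Contravariant functoriality: restriction is a homomorphism and so commutes with
  \<open>frag_eval\<close>, successive restrictions merge, and evaluating a linear extension is
  iterated evaluation.\<close>

lemma pull_pull:
  assumes \<phi>: "carried I A J B \<phi>" and \<psi>: "carried J B L D \<psi>" and c: "c \<in> carrier (sections L D)"
  shows "pull I A B \<phi> (pull J B D \<psi> c) = pull I A D (\<lambda>s. frag_extend \<psi> (\<phi> s)) c"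
proof -
  have "comm_group.frag_eval (F (A s)) (\<lambda>t. \<rho> (B t) (A s) (pull J B D \<psi> c t)) (\<phi> s) =
      comm_group.frag_eval (F (A s)) (\<lambda>u. \<rho> (D u) (A s) (c u)) (frag_extend \<psi> (\<phi> s))"
    if s: "s \<in> I" for s
  proof -
    interpret comm_group "F (A s)"
      using s \<phi> by (auto simp: carried_def intro: comm_group_sections)
    have ins: "t \<in> J" "A s \<subseteq> B t" "openin X (A s)" "openin X (B t)"
      if "t \<in> Poly_Mapping.keys (\<phi> s)" for t
      using that carriedD[OF \<phi> s] by auto
    have inu: "u \<in> L" "B t \<subseteq> D u" "openin X (D u)"
      if "t \<in> J" "u \<in> Poly_Mapping.keys (\<psi> t)" for t u
      using that carriedD[OF \<psi>] by auto
    have cl: "(\<lambda>u. \<rho> (D u) (A s) (c u)) \<in> Poly_Mapping.keys (\<psi> t) \<rightarrow> carrier (F (A s))"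
      if t: "t \<in> Poly_Mapping.keys (\<phi> s)" for t
      using ins[OF t] inu c by (fastforce simp: PiE_iff intro!: restriction_closed)
    have "frag_eval (\<lambda>t. \<rho> (B t) (A s) (pull J B D \<psi> c t)) (\<phi> s) =
        frag_eval (\<lambda>t. frag_eval (\<lambda>u. \<rho> (D u) (A s) (c u)) (\<psi> t)) (\<phi> s)"
    proof (rule frag_eval_cong)
      fix t assume t: "t \<in> Poly_Mapping.keys (\<phi> s)"
      note t' = ins[OF t]
      have "\<rho> (B t) (A s) (pull J B D \<psi> c t) =
          \<rho> (B t) (A s) (comm_group.frag_eval (F (B t)) (\<lambda>u. \<rho> (D u) (B t) (c u)) (\<psi> t))"
        using t' by (simp add: pull_def)
      also have "\<dots> = frag_eval (\<lambda>u. \<rho> (B t) (A s) (\<rho> (D u) (B t) (c u))) (\<psi> t)"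
        using t' restrict_cochain_closed[OF \<psi> _ c]
        by (intro hom_frag_eval comm_group_sections restriction_hom) auto
      also have "\<dots> = frag_eval (\<lambda>u. \<rho> (D u) (A s) (c u)) (\<psi> t)"
      proof (rule frag_eval_cong)
        fix u assume "u \<in> Poly_Mapping.keys (\<psi> t)"
        with t' inu[of t u] c show "\<rho> (B t) (A s) (\<rho> (D u) (B t) (c u)) = \<rho> (D u) (A s) (c u)"
          by (intro restriction_comp) (auto simp: PiE_iff)
      qed (rule cl[OF t])
      finally show "\<rho> (B t) (A s) (pull J B D \<psi> c t) = frag_eval (\<lambda>u. \<rho> (D u) (A s) (c u)) (\<psi> t)" .
    qed (use cl in auto)
    also have "\<dots> = frag_eval (\<lambda>u. \<rho> (D u) (A s) (c u)) (frag_extend \<psi> (\<phi> s))"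
      by (rule frag_eval_frag_extend[symmetric]) (rule cl)
    finally show ?thesis .
  qed
  then show ?thesis by (simp add: pull_def cong: restrict_cong)
qed

section \<open>Cochain complexes of families of lists\<close>

text \<open>What the two nerves share. Faces are demanded only from degree 1 on: all members are
  non-empty lists, so the augmentation \<open>[]\<close> never indexes a cochain.\<close>

definition open_nerve :: "(nat \<Rightarrow> 'b list set) \<Rightarrow> ('b list \<Rightarrow> 'a set) \<Rightarrow> bool" where
  "open_nerve S A \<longleftrightarrow>
     (\<forall>n. \<forall>s\<in>S n. length s = Suc n \<and> openin X (A s)) \<and>
     (\<forall>n. \<forall>s\<in>S (Suc n). \<forall>i\<le>Suc n. omit i s \<in> S n \<and> A s \<subseteq> A (omit i s))"

definition nerve_complex ::
    "(nat \<Rightarrow> 'b list set) \<Rightarrow> ('b list \<Rightarrow> 'a set) \<Rightarrow> ('b list \<Rightarrow> 'g) cochain_data" where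
  "nerve_complex S A =
     \<lparr>cochains = (\<lambda>n. sections (S n) A),
      codiff = (\<lambda>n c. \<lambda>s\<in>S (Suc n).
        \<Otimes>\<^bsub>F (A s)\<^esub>i\<in>{..Suc n}. \<rho> (A (omit i s)) (A s) (c (omit i s)) [^]\<^bsub>F (A s)\<^esub> ((-1) ^ i :: int))\<rparr>"

lemma open_nerveD:
  assumes "open_nerve S A" "s \<in> S n"
  shows "length s = Suc n" "s \<noteq> []" "openin X (A s)"
proof -
  show "length s = Suc n" "openin X (A s)"
    using assms by (auto simp: open_nerve_def)
  then show "s \<noteq> []" by auto
qed

lemma open_nerve_omit:
  assumes "open_nerve S A" "s \<in> S (Suc n)" "i \<le> Suc n"
  shows "omit i s \<in> S n" "A s \<subseteq> A (omit i s)"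
  using assms by (auto simp: open_nerve_def)

lemma open_nerve_singleton:
  assumes "open_nerve S A" "s \<in> S 0"
  obtains u where "s = [u]"
proof (cases s)
  case Nil
  with open_nerveD(1)[OF assms] show ?thesis by simp
next
  case (Cons u us)
  with open_nerveD(1)[OF assms] have "s = [u]" by simp
  then show ?thesis by (rule that)
qed

lemma cochains_nerve_complex [simp]: "cochains (nerve_complex S A) n = sections (S n) A"
  by (simp add: nerve_complex_def)

lemma carried_boundary:
  assumes "open_nerve S A"
  shows "carried (S (Suc n)) A (S n) A boundary"
  unfolding carried_def
proof (intro conjI ballI)
  fix s assume s: "s \<in> S (Suc n)"
  then have "length s = Suc (Suc n)" using assms by (auto simp: open_nerve_def)
  with s assms keys_boundary[of s] show "Poly_Mapping.keys (boundary s) \<subseteq> {t \<in> S n. A s \<subseteq> A t}"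
    by (fastforce simp: open_nerve_def less_Suc_eq_le)
qed (use assms in \<open>auto simp: open_nerve_def\<close>)

text \<open>Evaluating \<open>boundary s\<close> gives the signed product over the faces, the
  indices matching because \<open>s\<close> has \<open>Suc (Suc n)\<close> entries. From here on the
  codifferential is an instance of \<open>pull\<close>.\<close>

lemma codiff_nerve_complex:
  assumes S: "open_nerve S A" and c: "c \<in> carrier (sections (S n) A)"
  shows "codiff (nerve_complex S A) n c = pull (S (Suc n)) A A boundary c"
proof -
  have "(\<Otimes>\<^bsub>F (A s)\<^esub>i\<in>{..Suc n}. \<rho> (A (omit i s)) (A s) (c (omit i s)) [^]\<^bsub>F (A s)\<^esub> ((-1) ^ i :: int))
      = comm_group.frag_eval (F (A s)) (\<lambda>t. \<rho> (A t) (A s) (c t)) (boundary s)"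
    if s: "s \<in> S (Suc n)" for s
  proof -
    interpret comm_group "F (A s)"
      using s S by (auto simp: open_nerve_def intro: comm_group_sections)
    have len: "{..<length s} = {..Suc n}"
      using s S by (auto simp: open_nerve_def)
    have cl: "\<rho> (A (omit i s)) (A s) (c (omit i s)) \<in> carrier (F (A s))" if "i \<le> Suc n" for i
      using open_nerve_omit[OF S s that] open_nerveD(3)[OF S] s c
      by (intro restriction_closed) (auto simp: PiE_iff)
    have "frag_eval (\<lambda>t. \<rho> (A t) (A s) (c t)) (boundary s) =
        (\<Otimes>\<^bsub>F (A s)\<^esub>i\<in>{..<length s}.
          \<rho> (A (omit i s)) (A s) (c (omit i s)) [^]\<^bsub>F (A s)\<^esub> ((-1) ^ i :: int))"
      by (rule frag_eval_boundary) (use cl len in auto)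
    then show ?thesis by (simp only: len)
  qed
  then show ?thesis by (simp add: nerve_complex_def pull_def cong: restrict_cong)
qed

lemma cochain_complex_nerve_complex:
  assumes S: "open_nerve S A"
  shows "cochain_complex (nerve_complex S A)"
  unfolding cochain_complex_def cochains_nerve_complex
proof (intro conjI allI ballI)
  note d = carried_boundary[OF S]
  have op: "openin X (A s)" if "s \<in> S n" for n s
    using that S by (auto simp: open_nerve_def)
  show "comm_group (sections (S n) A)" for n
    using op by (intro comm_group_product_group comm_group_sections) auto
  \<comment> \<open>\<open>hom\<close> tests maps only on the carrier, where the two agree; closure
    under multiplication covers the products of cochains.\<close>
  have "codiff (nerve_complex S A) n \<in> hom (sections (S n) A) (sections (S (Suc n)) A) \<longleftrightarrow>
      pull (S (Suc n)) A A boundary \<in> hom (sections (S n) A) (sections (S (Suc n)) A)" for n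
    unfolding hom_def Pi_iff using codiff_nerve_complex[OF S]
      comm_groupE(1)[OF comm_group_product_group, of "S n" "\<lambda>s. F (A s)", OF comm_group_sections[OF op]]
    by simp
  then show "codiff (nerve_complex S A) n \<in> hom (sections (S n) A) (sections (S (Suc n)) A)" for n
    using pull_hom[OF d] by blast
  fix n c assume c: "c \<in> carrier (sections (S n) A)"
  have "codiff (nerve_complex S A) (Suc n) (codiff (nerve_complex S A) n c) =
      pull (S (Suc (Suc n))) A A boundary (pull (S (Suc n)) A A boundary c)"
    using codiff_nerve_complex[OF S] c pull_closed[OF d c] by simp
  \<comment> \<open>The composite is the action of the double boundary, which is the zero
    chain.\<close>
  also have "\<dots> = \<one>\<^bsub>sections (S (Suc (Suc n))) A\<^esub>"
    unfolding pull_pull[OF d d c] by (rule pull_zero) (auto intro: op)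
  finally show "codiff (nerve_complex S A) (Suc n) (codiff (nerve_complex S A) n c) =
      \<one>\<^bsub>sections (S (Suc (Suc n))) A\<^esub>" .
qed

section \<open>Cochain maps and homotopies induced by chains\<close>

lemma cochain_map_pull:
  assumes S: "open_nerve S A" and T: "open_nerve T B"
    and \<phi>: "is_chain_map \<phi>" "\<And>n. carried (S n) A (T n) B \<phi>"
  shows "cochain_map (nerve_complex T B) (nerve_complex S A) (\<lambda>n. pull (S n) A B \<phi>)"
  unfolding cochain_map_def cochains_nerve_complex
proof (intro conjI allI ballI)
  fix n c assume c: "c \<in> carrier (sections (T n) B)"
  have "pull (S (Suc n)) A B \<phi> (codiff (nerve_complex T B) n c) =
      pull (S (Suc n)) A B (\<lambda>s. frag_extend boundary (\<phi> s)) c"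
    unfolding codiff_nerve_complex[OF T c] using \<phi> carried_boundary[OF T] c by (intro pull_pull)
  also have "\<dots> = pull (S (Suc n)) A B (\<lambda>s. frag_extend \<phi> (boundary s)) c"
    using \<phi> by (simp add: is_chain_map_def)
  also have "\<dots> = pull (S (Suc n)) A A boundary (pull (S n) A B \<phi> c)"
    using \<phi> carried_boundary[OF S] c by (intro pull_pull[symmetric])
  also have "\<dots> = codiff (nerve_complex S A) n (pull (S n) A B \<phi> c)"
    by (rule codiff_nerve_complex[OF S pull_closed[OF \<phi>(2) c], symmetric])
  finally show "pull (S (Suc n)) A B \<phi> (codiff (nerve_complex T B) n c) =
      codiff (nerve_complex S A) n (pull (S n) A B \<phi> c)" .
qed (intro cochain_complex_nerve_complex S T pull_hom \<phi>(2))+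

text \<open>Since \<open>pull\<close> reverses composition,
  \<open>frag_extend h (boundary s)\<close> turns into the codifferential after \<open>h\<close>,
  and \<open>frag_extend boundary (h s)\<close> into \<open>h\<close> after the
  codifferential.\<close>

lemma cochain_homotopic_pull:
  assumes S: "open_nerve S A" and T: "open_nerve T B"
    and \<phi>: "is_chain_map \<phi>" "\<And>n. carried (S n) A (T n) B \<phi>"
    and \<psi>: "is_chain_map \<psi>" "\<And>n. carried (S n) A (T n) B \<psi>"
    and h: "\<And>n. carried (S n) A (T (Suc n)) B h" "h [] = 0"
      "\<And>s. frag_extend boundary (h s) + frag_extend h (boundary s) = \<phi> s - \<psi> s"
  shows "cochain_homotopic (nerve_complex T B) (nerve_complex S A)
    (\<lambda>n. pull (S n) A B \<phi>) (\<lambda>n. pull (S n) A B \<psi>)"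
  unfolding cochain_homotopic_def cochains_nerve_complex
proof (intro conjI exI[of _ "\<lambda>n. pull (S n) A B h"] allI ballI)
  note dS = carried_boundary[OF S] and dT = carried_boundary[OF T]
  fix c assume c: "c \<in> carrier (sections (T 0) B)"
  \<comment> \<open>The boundary of \<open>[u]\<close> is the augmentation term
    \<open>frag_of []\<close>, on which \<open>h\<close> vanishes; only one term of the homotopy
    identity survives, as required in degree 0.\<close>
  have "frag_extend boundary (h s) = \<phi> s - \<psi> s" if "s \<in> S 0" for s
  proof -
    obtain u where "s = [u]"
      using S \<open>s \<in> S 0\<close> by (rule open_nerve_singleton)
    then show ?thesis using h(2) h(3)[of s] by (simp add: boundary_Cons)
  qed
  then have "pull (S 0) A B (\<lambda>s. \<phi> s - \<psi> s) c = pull (S 0) A B (\<lambda>s. frag_extend boundary (h s)) c"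
    by (intro pull_cong) simp
  also have "\<dots> = pull (S 0) A B h (codiff (nerve_complex T B) 0 c)"
    unfolding codiff_nerve_complex[OF T c] by (rule pull_pull[symmetric]) (use h dT c in auto)
  finally show "pull (S 0) A B \<phi> c \<otimes>\<^bsub>sections (S 0) A\<^esub> inv\<^bsub>sections (S 0) A\<^esub> (pull (S 0) A B \<psi> c) =
      pull (S 0) A B h (codiff (nerve_complex T B) 0 c)"
    by (simp only: pull_diff[OF \<phi>(2) \<psi>(2) c])
next
  note dS = carried_boundary[OF S] and dT = carried_boundary[OF T]
  fix n c assume c: "c \<in> carrier (sections (T (Suc n)) B)"
  let ?S = "sections (S (Suc n)) A"
  have "pull (S (Suc n)) A B (\<lambda>s. \<phi> s - \<psi> s) c =
      pull (S (Suc n)) A B (\<lambda>s. frag_extend h (boundary s) + frag_extend boundary (h s)) c"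
    using h(3) by (simp add: add.commute)
  also have "\<dots> = pull (S (Suc n)) A B (\<lambda>s. frag_extend h (boundary s)) c \<otimes>\<^bsub>?S\<^esub>
      pull (S (Suc n)) A B (\<lambda>s. frag_extend boundary (h s)) c"
    using carried_compose[OF dS h(1)] carried_compose[OF h(1) dT] c by (rule pull_add)
  also have "pull (S (Suc n)) A B (\<lambda>s. frag_extend h (boundary s)) c =
      codiff (nerve_complex S A) n (pull (S n) A B h c)"
    unfolding codiff_nerve_complex[OF S pull_closed[OF h(1) c]]
    by (rule pull_pull[OF dS h(1) c, symmetric])
  also have "pull (S (Suc n)) A B (\<lambda>s. frag_extend boundary (h s)) c =
      pull (S (Suc n)) A B h (codiff (nerve_complex T B) (Suc n) c)"
    unfolding codiff_nerve_complex[OF T c] by (rule pull_pull[OF h(1) dT c, symmetric])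
  finally show "pull (S (Suc n)) A B \<phi> c \<otimes>\<^bsub>?S\<^esub> inv\<^bsub>?S\<^esub> (pull (S (Suc n)) A B \<psi> c) =
      codiff (nerve_complex S A) n (pull (S n) A B h c) \<otimes>\<^bsub>?S\<^esub>
      pull (S (Suc n)) A B h (codiff (nerve_complex T B) (Suc n) c)"
    by (simp only: pull_diff[OF \<phi>(2) \<psi>(2) c])
qed (intro cochain_map_pull S T \<phi> \<psi> pull_hom h(1))+

text \<open>The lists of \<open>T\<close> whose set contains \<open>A s\<close> form a cone with
  apex \<open>v s\<close>. The separate clause for \<open>[v s]\<close> is the cone over the
  augmentation \<open>[]\<close>, which belongs to no degree of an open nerve.\<close>

definition apex_map ::
    "(nat \<Rightarrow> 'b list set) \<Rightarrow> ('b list \<Rightarrow> 'a set) \<Rightarrow> (nat \<Rightarrow> 'c list set) \<Rightarrow> ('c list \<Rightarrow> 'a set) \<Rightarrow>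
      ('b list \<Rightarrow> 'c) \<Rightarrow> bool" where
  "apex_map S A T B v \<longleftrightarrow> (\<forall>n. \<forall>s\<in>S n.
     [v s] \<in> T 0 \<and> A s \<subseteq> B [v s] \<and>
     (\<forall>m. \<forall>t\<in>T m. A s \<subseteq> B t \<longrightarrow> v s # t \<in> T (Suc m) \<and> A s \<subseteq> B (v s # t)))"

lemma keys_cone_apex:
  assumes "apex_map S A T B v" "s \<in> S n" "Poly_Mapping.keys a \<subseteq> {t \<in> T m. A s \<subseteq> B t}"
  shows "Poly_Mapping.keys (cone (v s) a) \<subseteq> {t \<in> T (Suc m). A s \<subseteq> B t}"
proof -
  have "v s # t \<in> {t \<in> T (Suc m). A s \<subseteq> B t}" if "t \<in> {t \<in> T m. A s \<subseteq> B t}" for t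
    using assms(1,2) that unfolding apex_map_def by blast
  then show ?thesis
    using assms(3) keys_cone[of "v s" a] by blast
qed

text \<open>A face \<open>t\<close> of \<open>s\<close> has \<open>A s \<subseteq> A t\<close>, so
  lists admissible over \<open>A t\<close> are admissible over \<open>A s\<close>, and coning from
  \<open>v s\<close> keeps them so.\<close>

lemma carried_cone_map:
  assumes S: "open_nerve S A" and T: "open_nerve T B" and v: "apex_map S A T B v"
  shows "carried (S n) A (T n) B (cone_map v)"
proof (induction n)
  case 0
  \<comment> \<open>Degree 0 is separate because the only face of \<open>[u]\<close> is
    \<open>[]\<close>, which lies in no degree of the nerve.\<close>
  have "cone_map v s = frag_of [v s]" if "s \<in> S 0" for s
  proof -
    obtain u where "s = [u]"
      using S \<open>s \<in> S 0\<close> by (rule open_nerve_singleton)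
    then show ?thesis by (simp add: cone_map_nonempty boundary_Cons)
  qed
  with S T v show ?case by (auto simp: carried_def open_nerve_def apex_map_def)
next
  case (Suc n)
  show ?case
    unfolding carried_def
  proof (intro conjI ballI)
    fix s assume s: "s \<in> S (Suc n)"
    then have "s \<noteq> []" by (rule open_nerveD(2)[OF S])
    moreover have "Poly_Mapping.keys (frag_extend (cone_map v) (boundary s)) \<subseteq> {t \<in> T n. A s \<subseteq> B t}"
      using carried_compose[OF carried_boundary[OF S] Suc] s by (simp add: carried_def)
    ultimately show "Poly_Mapping.keys (cone_map v s) \<subseteq> {t \<in> T (Suc n). A s \<subseteq> B t}"
      using keys_cone_apex[OF v s] by (simp add: cone_map_nonempty)
  qed (use S T in \<open>auto simp: open_nerve_def\<close>)
qed

text \<open>As for \<open>carried_cone_map\<close>, one degree higher: for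
  \<open>s \<in> S (Suc n)\<close>, both \<open>D s\<close> and the homotopy on the faces are
  supported in \<open>T (Suc n)\<close>, and coning adds one.\<close>

lemma carried_cone_homotopy:
  assumes S: "open_nerve S A" and T: "open_nerve T B" and v: "apex_map S A T B v"
    and D: "\<And>n. carried (S n) A (T n) B D"
  shows "carried (S n) A (T (Suc n)) B (cone_homotopy v D)"
proof (induction n)
  case 0
  have "cone_homotopy v D s = cone (v s) (D s)" if "s \<in> S 0" for s
  proof -
    obtain u where "s = [u]"
      using S \<open>s \<in> S 0\<close> by (rule open_nerve_singleton)
    then show ?thesis by (simp add: cone_homotopy_nonempty boundary_Cons)
  qed
  moreover have "Poly_Mapping.keys (cone (v s) (D s)) \<subseteq> {t \<in> T (Suc 0). A s \<subseteq> B t}"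
    if "s \<in> S 0" for s
    using D[of 0] that by (intro keys_cone_apex[OF v that]) (auto simp: carried_def)
  ultimately show ?case
    using S T by (simp add: carried_def open_nerve_def)
next
  case (Suc n)
  note d = carried_diff[OF D carried_compose[OF carried_boundary[OF S] Suc]]
  show ?case
    unfolding carried_def
  proof (intro conjI ballI)
    fix s assume s: "s \<in> S (Suc n)"
    then have "s \<noteq> []" by (rule open_nerveD(2)[OF S])
    moreover have "Poly_Mapping.keys (D s - frag_extend (cone_homotopy v D) (boundary s))
        \<subseteq> {t \<in> T (Suc n). A s \<subseteq> B t}"
      using d s by (simp add: carried_def)
    ultimately show "Poly_Mapping.keys (cone_homotopy v D s) \<subseteq> {t \<in> T (Suc (Suc n)). A s \<subseteq> B t}"
      using keys_cone_apex[OF v s] by (simp add: cone_homotopy_nonempty del: cone_simps)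
  qed (use S T in \<open>auto simp: open_nerve_def\<close>)
qed

text \<open>The acyclic carrier principle: augmentation-preserving chain maps carried by the same
  family of cones are homotopic, by a homotopy respecting the carrier.\<close>

lemma cochain_homotopic_of_apex_map:
  assumes S: "open_nerve S A" and T: "open_nerve T B"
    and \<phi>: "is_chain_map \<phi>" "\<And>n. carried (S n) A (T n) B \<phi>"
    and \<psi>: "is_chain_map \<psi>" "\<And>n. carried (S n) A (T n) B \<psi>"
    and v: "apex_map S A T B v"
  shows "cochain_homotopic (nerve_complex T B) (nerve_complex S A)
    (\<lambda>n. pull (S n) A B \<phi>) (\<lambda>n. pull (S n) A B \<psi>)"
proof (rule cochain_homotopic_pull[OF S T \<phi> \<psi>])
  let ?h = "cone_homotopy v (\<lambda>s. \<phi> s - \<psi> s)"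
  show "carried (S n) A (T (Suc n)) B ?h" for n
    by (rule carried_cone_homotopy[OF S T v carried_diff[OF \<phi>(2) \<psi>(2)]])
  show "frag_extend boundary (?h s) + frag_extend ?h (boundary s) = \<phi> s - \<psi> s" for s
    using \<phi>(1) \<psi>(1) by (rule cone_homotopy)
qed simp

text \<open>\<open>cone_map v\<close> provides the inverse. Each composite has the same carrier as
  the identity chain map \<open>frag_of\<close>, so \<open>w\<close> and \<open>u\<close> yield the
  two homotopies.\<close>

theorem cochain_homotopy_equivalence_pull:
  assumes S: "open_nerve S A" and T: "open_nerve T B"
    and \<phi>: "is_chain_map \<phi>" "\<And>n. carried (T n) B (S n) A \<phi>"
    and v: "apex_map S A T B v" and w: "apex_map S A S A w" and u: "apex_map T B T B u"
  shows "cochain_homotopy_equivalence (nerve_complex S A) (nerve_complex T B)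
    (\<lambda>n. pull (T n) B A \<phi>)"
proof -
  let ?C = "nerve_complex S A" and ?D = "nerve_complex T B" and ?\<gamma> = "cone_map v"
  note \<gamma> = is_chain_map_cone_map[of v] carried_cone_map[OF S T v]
  have id: "is_chain_map frag_of" "\<And>n. carried (S n) A (S n) A frag_of"
      "\<And>n. carried (T n) B (T n) B frag_of"
    using S T is_chain_map_frag_of by (auto simp: carried_def open_nerve_def)
  have opS: "openin X (A s)" if "s \<in> S n" for s n
    using S that by (simp add: open_nerve_def)
  have opT: "openin X (B t)" if "t \<in> T n" for t n
    using T that by (simp add: open_nerve_def)
  \<comment> \<open>By contravariance, \<open>\<phi>\<close> followed by \<open>?\<gamma>\<close> on
    cochains is \<open>?\<gamma>\<close> followed by \<open>\<phi>\<close> on chains.\<close>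
  have "cochain_homotopic ?C ?C (\<lambda>n. pull (S n) A A (\<lambda>s. frag_extend \<phi> (?\<gamma> s)))
      (\<lambda>n. pull (S n) A A frag_of)"
    using S S is_chain_map_compose[OF \<gamma>(1) \<phi>(1)] carried_compose[OF \<gamma>(2) \<phi>(2)] id(1,2) w
    by (rule cochain_homotopic_of_apex_map)
  then have "cochain_homotopic ?C ?C (\<lambda>n. pull (S n) A B ?\<gamma> \<circ> pull (T n) B A \<phi>) (\<lambda>n. id)"
    by (rule cochain_homotopic_cong)
      (simp_all only: cochains_nerve_complex o_apply id_apply pull_pull[OF \<gamma>(2) \<phi>(2)] pull_id[OF opS])
  moreover have "cochain_homotopic ?D ?D (\<lambda>n. pull (T n) B B (\<lambda>t. frag_extend ?\<gamma> (\<phi> t)))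
      (\<lambda>n. pull (T n) B B frag_of)"
    using T T is_chain_map_compose[OF \<phi>(1) \<gamma>(1)] carried_compose[OF \<phi>(2) \<gamma>(2)] id(1,3) u
    by (rule cochain_homotopic_of_apex_map)
  then have "cochain_homotopic ?D ?D (\<lambda>n. pull (T n) B A \<phi> \<circ> pull (S n) A B ?\<gamma>) (\<lambda>n. id)"
    by (rule cochain_homotopic_cong)
      (simp_all only: cochains_nerve_complex o_apply id_apply pull_pull[OF \<phi>(2) \<gamma>(2)] pull_id[OF opT])
  ultimately show ?thesis
    unfolding cochain_homotopy_equivalence_def
    using cochain_map_pull[OF T S \<phi>] cochain_map_pull[OF S T \<gamma>] by blast
qed

end

section \<open>The nerves of a covering\<close>

lemma sorted_wrt_omit:
  assumes "sorted_wrt R xs"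
  shows "sorted_wrt R (omit i xs)"
proof -
  have "sorted_wrt R (take i xs @ drop i xs)"
    using assms by simp
  moreover have "set (drop (Suc i) xs) \<subseteq> set (drop i xs)"
    by (rule set_drop_subset_set_drop) simp
  ultimately show ?thesis
    using sorted_wrt_drop[OF assms] unfolding omit_def sorted_wrt_append by blast
qed

lemma hd_subset_of_sorted: "sorted_wrt (\<subseteq>) vs \<Longrightarrow> v \<in> set vs \<Longrightarrow> hd vs \<subseteq> v"
  by (cases vs) auto

lemma openin_finite_intersections:
  assumes "open_covering X \<U>" "V \<in> finite_intersections \<U>"
  shows "openin X V"
  using assms openin_Inter unfolding finite_intersections_def open_covering_def by blast

text \<open>This allows \<open>\<pi>\<close> to be applied to the intersection, and the intersection
  to serve as a vertex of the category nerve.\<close>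

lemma Inter_cech_nerve:
  assumes "us \<in> cech_nerve \<U> n"
  shows "\<Inter>(set us) \<in> finite_intersections \<U>"
proof -
  have "set us \<subseteq> \<U>" "finite (set us)" "set us \<noteq> {}" "\<Inter>(set us) \<noteq> {}"
    using assms by (auto simp: cech_nerve_def)
  then show ?thesis unfolding finite_intersections_def by blast
qed

lemma hd_category_nerve:
  assumes "vs \<in> category_nerve \<U> n"
  shows "hd vs \<in> finite_intersections \<U>" "v \<in> set vs \<Longrightarrow> hd vs \<subseteq> v"
proof -
  have "vs \<noteq> []" "set vs \<subseteq> finite_intersections \<U>" "sorted_wrt (\<subseteq>) vs"
    using assms by (auto simp: category_nerve_def)
  then show "hd vs \<in> finite_intersections \<U>" "v \<in> set vs \<Longrightarrow> hd vs \<subseteq> v"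
    using hd_subset_of_sorted by auto
qed

lemma (in abelian_presheaf) open_nerve_cech:
  assumes "open_covering X \<U>"
  shows "open_nerve (cech_nerve \<U>) (\<lambda>us. \<Inter>(set us))"
  unfolding open_nerve_def
proof (intro conjI allI ballI impI)
  fix n us
  assume us: "us \<in> cech_nerve \<U> n"
  show "length us = Suc n" using us by (simp add: cech_nerve_def)
  show "openin X (\<Inter>(set us))"
    using assms Inter_cech_nerve[OF us] by (rule openin_finite_intersections)
next
  fix n us i
  assume us: "us \<in> cech_nerve \<U> (Suc n)" and i: "i \<le> Suc n"
  then have "length (omit i us) = Suc n" by (simp add: cech_nerve_def length_omit)
  with us show "omit i us \<in> cech_nerve \<U> n"
    using set_omit_subset[of i us] unfolding cech_nerve_def by blast
  show "\<Inter>(set us) \<subseteq> \<Inter>(set (omit i us))"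
    using set_omit_subset by (rule Inter_anti_mono)
qed

lemma (in abelian_presheaf) open_nerve_category:
  assumes "open_covering X \<U>"
  shows "open_nerve (category_nerve \<U>) hd"
  unfolding open_nerve_def
proof (intro conjI allI ballI impI)
  fix n vs
  assume vs: "vs \<in> category_nerve \<U> n"
  show "length vs = Suc n" using vs by (simp add: category_nerve_def)
  show "openin X (hd vs)"
    using assms hd_category_nerve(1)[OF vs] by (rule openin_finite_intersections)
next
  fix n vs i
  assume vs: "vs \<in> category_nerve \<U> (Suc n)" and i: "i \<le> Suc n"
  then have len: "length (omit i vs) = Suc n" by (simp add: category_nerve_def length_omit)
  with vs show "omit i vs \<in> category_nerve \<U> n"
    using set_omit_subset[of i vs] sorted_wrt_omit unfolding category_nerve_def by blast
  \<comment> \<open>Even for \<open>i = 0\<close> the new head is an entry of \<open>vs\<close>, and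
    the old head is contained in every entry.\<close>
  have "hd (omit i vs) \<in> set vs"
    using len set_omit_subset by (metis hd_in_set length_0_conv nat.distinct(1) subsetD)
  then show "hd vs \<subseteq> hd (omit i vs)" by (rule hd_category_nerve(2)[OF vs])
qed

theorem theorem6p31:
  fixes X :: "'a topology"
    and \<U> :: "'a set set"
    and F :: "'a set \<Rightarrow> ('g, 'm) monoid_scheme"
    and \<rho> :: "'a set \<Rightarrow> 'a set \<Rightarrow> 'g \<Rightarrow> 'g"
    and \<pi> :: "'a set \<Rightarrow> 'a set"
  assumes "open_covering X \<U>"
    and "abelian_presheaf X F \<rho>"
    and "\<pi> \<in> finite_intersections \<U> \<rightarrow> \<U>"
    and "\<And>V. V \<in> finite_intersections \<U> \<Longrightarrow> V \<subseteq> \<pi> V"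
    and "\<And>U. U \<in> \<U> \<Longrightarrow> U \<in> finite_intersections \<U> \<Longrightarrow> \<pi> U = U"
  shows "cochain_homotopy_equivalence (cech_complex \<U> F \<rho>) (category_complex \<U> F \<rho>)
           (nerve_pullback \<U> \<rho> \<pi>)"
proof -
  interpret abelian_presheaf X F \<rho> by fact
  let ?K = "cech_nerve \<U>" and ?N = "category_nerve \<U>"
  let ?I = "\<lambda>us. \<Inter>(set us) :: 'a set"
  let ?p = "\<lambda>vs. frag_of (map \<pi> vs)"
  note K = open_nerve_cech[OF assms(1)] and N = open_nerve_category[OF assms(1)]
  have complexes: "cech_complex \<U> F \<rho> = nerve_complex ?K ?I"
      "category_complex \<U> F \<rho> = nerve_complex ?N hd"
    by (simp_all add: cech_complex_def category_complex_def nerve_complex_def)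
  have nonempty: "V \<noteq> {}" if "V \<in> finite_intersections \<U>" for V
    using that by (auto simp: finite_intersections_def)
  have \<pi>: "\<pi> V \<in> \<U>" "V \<subseteq> \<pi> V" if "V \<in> finite_intersections \<U>" for V
    using that assms(3,4) by auto

  \<comment> \<open>\<open>W\<close>, a non-empty set inside the common intersection, witnesses that
    the latter is non-empty.\<close>
  have in_cech: "us \<in> ?K n"
    if "length us = Suc n" "set us \<subseteq> \<U>" "W \<subseteq> ?I us" "W \<in> finite_intersections \<U>" for us n W
    using that nonempty[of W] unfolding cech_nerve_def by blast
  have carried_p: "carried (?N n) hd (?K n) ?I ?p" for n
    unfolding carried_def
  proof (intro conjI ballI)
    fix vs assume vs: "vs \<in> ?N n"
    then have set: "set vs \<subseteq> finite_intersections \<U>" and len: "length vs = Suc n"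
      by (auto simp: category_nerve_def)
    \<comment> \<open>The head is contained in each entry \<open>V\<close>, and
      \<open>V \<subseteq> \<pi> V\<close>.\<close>
    have sub: "hd vs \<subseteq> ?I (map \<pi> vs)"
      using hd_category_nerve(2)[OF vs] set \<pi>(2) by fastforce
    moreover have "map \<pi> vs \<in> ?K n"
      by (rule in_cech[OF _ _ sub hd_category_nerve(1)[OF vs]]) (use len set \<pi>(1) in auto)
    ultimately show "Poly_Mapping.keys (?p vs) \<subseteq> {us \<in> ?K n. hd vs \<subseteq> ?I us}" by simp
  qed (use K N in \<open>auto dest: open_nerveD(3)\<close>)

  \<comment> \<open>With \<open>W = ?I us\<close>, the apex \<open>\<pi> W\<close> is a member of
    the covering containing \<open>W\<close>, so adding it to a list whose intersection contains
    \<open>W\<close> preserves that property.\<close>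
  have apex_cech: "apex_map ?K ?I ?K ?I (\<lambda>us. \<pi> (?I us))"
    unfolding apex_map_def
  proof (intro conjI allI ballI impI)
    fix n us assume us: "us \<in> ?K n"
    note W = Inter_cech_nerve[OF us]
    show "[\<pi> (?I us)] \<in> ?K 0"
      using \<pi>[OF W] by (intro in_cech[OF _ _ _ W]) auto
    show "?I us \<subseteq> ?I [\<pi> (?I us)]"
      using \<pi>(2)[OF W] by simp
    fix m ts assume ts: "ts \<in> ?K m" "?I us \<subseteq> ?I ts"
    show sub: "?I us \<subseteq> ?I (\<pi> (?I us) # ts)"
      using ts \<pi>(2)[OF W] by simp
    show "\<pi> (?I us) # ts \<in> ?K (Suc m)"
      by (rule in_cech[OF _ _ sub W]) (use ts \<pi>(1)[OF W] in \<open>auto simp: cech_nerve_def\<close>)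
  qed
  \<comment> \<open>The head is the least entry, so \<open>W\<close> below the head is below every
    entry.\<close>
  have in_category: "W # vs \<in> ?N (Suc n)"
    if "W \<in> finite_intersections \<U>" "vs \<in> ?N n" "W \<subseteq> hd vs" for W vs n
    using that hd_category_nerve(2)[OF that(2)] by (fastforce simp: category_nerve_def)
  have singleton_category: "[W] \<in> ?N 0" if "W \<in> finite_intersections \<U>" for W
    using that by (simp add: category_nerve_def)
  \<comment> \<open>With the intersection itself as apex, \<open>cone_map\<close> is barycentric
    subdivision: a signed sum of flags of intersections of sublists, the full intersection coming
    first.\<close>
  have apex_cech_category: "apex_map ?K ?I ?N hd ?I"
    unfolding apex_map_def list.sel
    using Inter_cech_nerve in_category singleton_category by blast
  have apex_category: "apex_map ?N hd ?N hd hd"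
    unfolding apex_map_def list.sel
    using hd_category_nerve(1) in_category singleton_category by blast

  have equiv: "cochain_homotopy_equivalence (nerve_complex ?K ?I) (nerve_complex ?N hd)
      (\<lambda>n. pull (?N n) hd ?I ?p)"
    using K N is_chain_map_map carried_p apex_cech_category apex_cech apex_category
    by (rule cochain_homotopy_equivalence_pull)
  \<comment> \<open>Evaluating the one-term chain \<open>?p vs\<close> gives the restricted value at
    \<open>map \<pi> vs\<close> when \<open>c\<close> is an actual cochain; hence the final passage
    through a congruence rule.\<close>
  have "nerve_pullback \<U> \<rho> \<pi> n c = pull (?N n) hd ?I ?p c"
    if "c \<in> carrier (cochains (nerve_complex ?K ?I) n)" for n c
    using pull_frag_of[OF carried_p, of c n] that by (simp add: nerve_pullback_def)
  then show ?thesis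
    unfolding complexes by (rule cochain_homotopy_equivalence_cong[OF equiv])
qed

end
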